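(* For arbitrary star-finite pointed simplicial models $(\mathcal C,X)$ and $(\mathcal C',X')$, \[ (\mathcal C,X)\equiv_{\mathcal L^+}(\mathcal C',X') \quad\Longleftrightarrow\quad (\mathcal C,X)\mathrel{\underline{\leftrightarrow}}(\mathcal C',X'). \]
   Context: Let $A$ be a finite set of agents and, for each $a\in A$, $P_a$ a countable set of local atoms (mutually disjoint). The language $\mathcal L^+$ is $\varphi ::= a \mid p_a \mid \neg\varphi \mid (\varphi\wedge\varphi)\mid \widehat K_a\varphi$ with $a\in A$ (global atom "agent $a$ is alive") and $p_a\in P_a$. A simplicial model $\mathcal C=(C,\chi,\ell)$ consists of a nonempty downward-closed set $C$ of nonempty finite subsets (simplexes) of a vertex set containing all singletons, a chromatic map $\chi$ from vertices to agents injective on each simplex, and a valuation $\ell$ assigning to each vertex $v$ a subset of $P_{\chi(v)}$; $\chi(X)$ and $\ell(X)$ are the unions over vertices of $X$; $\mathcal F(C)$ is the set of facets; a pointed model is $(\mathcal C,X)$ with $X\in\mathcal F(C)$. A simplicial model is star-finite iff for each agent $a$, every facet has only finitely many facets $Y$ with $a\in\chi(X\cap Y)$. Three-valued semantics on facets: definability $\bowtie$: $a$ always defined; $p_a$ defined iff $a\in\chi(X)$; $\neg\varphi$ defined iff $\varphi$ is; $\varphi\wedge\psi$ defined iff both are; $\widehat K_a\varphi$ defined iff $\varphi$ is defined in some facet $Y$ with $a\in\chi(X\cap Y)$. Truth $\vDash$: $a$ true iff $a\in\chi(X)$; $p_a$ true iff $p_a\in\ell(X)$; $\neg\varphi$ true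 iff $\varphi$ defined and not true; $\varphi\wedge\psi$ true iff both true; $\widehat K_a\varphi$ true iff $\varphi$ true in some facet $Y$ with $a\in\chi(X\cap Y)$. $(\mathcal C,X)\equiv_{\mathcal L^+}(\mathcal C',X')$ means that for every $\varphi\in\mathcal L^+$, $\varphi$ is defined/true/has true negation in $(\mathcal C,X)$ iff the same holds in $(\mathcal C',X')$. A bisimulation between $\mathcal C$ and $\mathcal C'$ is a nonempty relation $\mathcal B\subseteq\mathcal F(C)\times\mathcal F(C')$ such that whenever $X\mathcal B X'$: (atoms) $\chi(X)=\chi'(X')$ and $\ell(X)=\ell'(X')$; (forth) for each $a$ and each facet $Y$ with $a\in\chi(X\cap Y)$ there is a facet $Y'$ with $a\in\chi'(X'\cap Y')$ and $Y\mathcal B Y'$; (back) symmetrically. $(\mathcal C,X)\mathrel{\underline{\leftrightarrow}}(\mathcal C',X')$ means there is a bisimulation relating $X$ and $X'$. *)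

theory Defs
  imports Main "HOL-Library.Countable_Set" "HOL-Library.Disjoint_Sets"
begin

text \<open>The term \<open>Local a p\<close> stands for the local atom \<open>p\<^sub>a\<close>; it belongs to the language
  only if \<open>p\<close> is one of the local atoms of agent \<open>a\<close>. The constructor \<open>Dia a\<close> is the
  epistemic diamond (dual of knowledge) of agent \<open>a\<close>.\<close>

datatype ('a, 'p) fm =
    Alive 'a
  | Local 'a 'p
  | Neg "('a, 'p) fm"
  | Conj "('a, 'p) fm" "('a, 'p) fm"
  | Dia 'a "('a, 'p) fm"

inductive_set lang_plus :: "'a set \<Rightarrow> ('a \<Rightarrow> 'p set) \<Rightarrow> ('a, 'p) fm set"
  for A :: "'a set" and P :: "'a \<Rightarrow> 'p set" where
  Alive: "a \<in> A \<Longrightarrow> Alive a \<in> lang_plus A P"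
| Local: "a \<in> A \<Longrightarrow> p \<in> P a \<Longrightarrow> Local a p \<in> lang_plus A P"
| Neg: "\<phi> \<in> lang_plus A P \<Longrightarrow> Neg \<phi> \<in> lang_plus A P"
| Conj: "\<phi> \<in> lang_plus A P \<Longrightarrow> \<psi> \<in> lang_plus A P \<Longrightarrow> Conj \<phi> \<psi> \<in> lang_plus A P"
| Dia: "a \<in> A \<Longrightarrow> \<phi> \<in> lang_plus A P \<Longrightarrow> Dia a \<phi> \<in> lang_plus A P"

record ('v, 'a, 'p) smodel =
  verts :: "'v set"
  simplexes :: "'v set set"
  colour :: "'v \<Rightarrow> 'a"
  val :: "'v \<Rightarrow> 'p set"

locale simplicial_model =
  fixes A :: "'a set" and P :: "'a \<Rightarrow> 'p set" and M :: "('v, 'a, 'p) smodel"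
  assumes nonempty: "simplexes M \<noteq> {}"
    and simplex: "S \<in> simplexes M \<Longrightarrow> S \<noteq> {} \<and> finite S \<and> S \<subseteq> verts M"
    and down_closed: "S \<in> simplexes M \<Longrightarrow> T \<noteq> {} \<Longrightarrow> T \<subseteq> S \<Longrightarrow> T \<in> simplexes M"
    and singletons: "v \<in> verts M \<Longrightarrow> {v} \<in> simplexes M"
    and colour_agent: "v \<in> verts M \<Longrightarrow> colour M v \<in> A"
    and chromatic: "S \<in> simplexes M \<Longrightarrow> inj_on (colour M) S"
    and val_local: "v \<in> verts M \<Longrightarrow> val M v \<subseteq> P (colour M v)"

definition facets :: "('v, 'a, 'p) smodel \<Rightarrow> 'v set set" where
  "facets M = {X \<in> simplexes M. \<forall>Y \<in> simplexes M. X \<subseteq> Y \<longrightarrow> X = Y}"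

definition colours :: "('v, 'a, 'p) smodel \<Rightarrow> 'v set \<Rightarrow> 'a set" where
  "colours M X = colour M ` X"

definition vals :: "('v, 'a, 'p) smodel \<Rightarrow> 'v set \<Rightarrow> 'p set" where
  "vals M X = (\<Union>v\<in>X. val M v)"

definition star :: "('v, 'a, 'p) smodel \<Rightarrow> 'a \<Rightarrow> 'v set \<Rightarrow> 'v set set" where
  "star M a X = {Y \<in> facets M. a \<in> colours M (X \<inter> Y)}"

definition star_finite :: "'a set \<Rightarrow> ('v, 'a, 'p) smodel \<Rightarrow> bool" where
  "star_finite A M \<longleftrightarrow> (\<forall>a\<in>A. \<forall>X\<in>facets M. finite (star M a X))"

primrec defd :: "('v, 'a, 'p) smodel \<Rightarrow> 'v set \<Rightarrow> ('a, 'p) fm \<Rightarrow> bool" where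
  "defd M X (Alive a) \<longleftrightarrow> True"
| "defd M X (Local a p) \<longleftrightarrow> a \<in> colours M X"
| "defd M X (Neg \<phi>) \<longleftrightarrow> defd M X \<phi>"
| "defd M X (Conj \<phi> \<psi>) \<longleftrightarrow> defd M X \<phi> \<and> defd M X \<psi>"
| "defd M X (Dia a \<phi>) \<longleftrightarrow> (\<exists>Y\<in>star M a X. defd M Y \<phi>)"

primrec sat :: "('v, 'a, 'p) smodel \<Rightarrow> 'v set \<Rightarrow> ('a, 'p) fm \<Rightarrow> bool" where
  "sat M X (Alive a) \<longleftrightarrow> a \<in> colours M X"
| "sat M X (Local a p) \<longleftrightarrow> p \<in> vals M X"
| "sat M X (Neg \<phi>) \<longleftrightarrow> defd M X \<phi> \<and> \<not> sat M X \<phi>"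
| "sat M X (Conj \<phi> \<psi>) \<longleftrightarrow> sat M X \<phi> \<and> sat M X \<psi>"
| "sat M X (Dia a \<phi>) \<longleftrightarrow> (\<exists>Y\<in>star M a X. sat M Y \<phi>)"

definition equiv_plus :: "'a set \<Rightarrow> ('a \<Rightarrow> 'p set) \<Rightarrow>
    ('v, 'a, 'p) smodel \<Rightarrow> 'v set \<Rightarrow> ('w, 'a, 'p) smodel \<Rightarrow> 'w set \<Rightarrow> bool" where
  "equiv_plus A P M X M' X' \<longleftrightarrow>
    (\<forall>\<phi>\<in>lang_plus A P.
      (defd M X \<phi> \<longleftrightarrow> defd M' X' \<phi>) \<and>
      (sat M X \<phi> \<longleftrightarrow> sat M' X' \<phi>) \<and>
      (sat M X (Neg \<phi>) \<longleftrightarrow> sat M' X' (Neg \<phi>)))"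

definition bisimulation :: "'a set \<Rightarrow>
    ('v, 'a, 'p) smodel \<Rightarrow> ('w, 'a, 'p) smodel \<Rightarrow> ('v set \<times> 'w set) set \<Rightarrow> bool" where
  "bisimulation A M M' B \<longleftrightarrow>
    B \<noteq> {} \<and> B \<subseteq> facets M \<times> facets M' \<and>
    (\<forall>(X, X')\<in>B.
      colours M X = colours M' X' \<and> vals M X = vals M' X' \<and>
      (\<forall>a\<in>A. \<forall>Y\<in>star M a X. \<exists>Y'\<in>star M' a X'. (Y, Y') \<in> B) \<and>
      (\<forall>a\<in>A. \<forall>Y'\<in>star M' a X'. \<exists>Y\<in>star M a X. (Y, Y') \<in> B))"

definition bisimilar :: "'a set \<Rightarrow>
    ('v, 'a, 'p) smodel \<Rightarrow> 'v set \<Rightarrow> ('w, 'a, 'p) smodel \<Rightarrow> 'w set \<Rightarrow> bool" where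
  "bisimilar A M X M' X' \<longleftrightarrow> (\<exists>B. bisimulation A M M' B \<and> (X, X') \<in> B)"

end

theory Submission
  imports Defs
begin

text \<open>
  Bisimilarity implies equivalence by induction on formulas. Conversely, equivalence is itself a
  bisimulation; by star-finiteness, the Hennessy--Milner argument applies once any two inequivalent
  facets \<open>Y\<close>, \<open>Y'\<close> are separated by a formula true in \<open>Y\<close> but not in \<open>Y'\<close>. The delicate case is
  a formula \<open>\<phi>\<close> undefined in \<open>Y\<close> and defined in \<open>Y'\<close>. Definedness of \<open>\<phi>\<close> is expressed by a
  formula \<open>\<delta>\<close>, true in \<open>Y'\<close> and not in \<open>Y\<close>. If \<open>\<delta>\<close> is defined in \<open>Y\<close>, then \<open>\<not>\<delta>\<close> separates;
  otherwise \<open>\<delta>\<close> is again undefined in \<open>Y\<close> and defined in \<open>Y'\<close>, and one repeats the argument. This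
  stops because passing from \<open>\<phi>\<close> to \<open>\<delta>\<close> lowers a rank, and formulas of rank 0 are always defined.
\<close>

section \<open>Expressing definedness in the language\<close>

text \<open>Non-contradiction as a three-valued test: itself undefined wherever
  \<open>\<phi>\<close> is, and of the same rank. Lowering the rank is left to
  \<open>defd_fm\<close>.\<close>

definition defd_taut :: "('a, 'p) fm \<Rightarrow> ('a, 'p) fm" where
  "defd_taut \<phi> = Neg (Conj \<phi> (Neg \<phi>))"

lemma sat_defd_taut [simp]: "sat M X (defd_taut \<phi>) \<longleftrightarrow> defd M X \<phi>"
  by (auto simp: defd_taut_def)

lemma defd_taut_in_lang [intro]: "\<phi> \<in> lang_plus A P \<Longrightarrow> defd_taut \<phi> \<in> lang_plus A P"
  unfolding defd_taut_def by (intro lang_plus.intros)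

text \<open>Nesting depth of the sources of undefinedness: \<open>Local\<close> requires its agent
  to be alive, \<open>Dia\<close> a facet of the star in which the argument is defined.\<close>

primrec defd_rank :: "('a, 'p) fm \<Rightarrow> nat" where
  "defd_rank (Alive a) = 0"
| "defd_rank (Local a p) = 1"
| "defd_rank (Neg \<phi>) = defd_rank \<phi>"
| "defd_rank (Conj \<phi> \<psi>) = max (defd_rank \<phi>) (defd_rank \<psi>)"
| "defd_rank (Dia a \<phi>) = Suc (defd_rank \<phi>)"

text \<open>In the case of \<open>Dia a \<phi>\<close> with \<open>\<phi>\<close> of rank 0, the formula \<open>Dia a (defd_fm \<phi>)\<close> would
  also express definedness, but it would not have smaller rank.\<close>

primrec defd_fm :: "('a, 'p) fm \<Rightarrow> ('a, 'p) fm" where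
  "defd_fm (Alive a) = defd_taut (Alive a)"
| "defd_fm (Local a p) = Alive a"
| "defd_fm (Neg \<phi>) = defd_fm \<phi>"
| "defd_fm (Conj \<phi> \<psi>) = Conj (defd_fm \<phi>) (defd_fm \<psi>)"
| "defd_fm (Dia a \<phi>) = (if defd_rank \<phi> = 0 then Alive a else Dia a (defd_fm \<phi>))"

lemma defd_rank_0: "defd_rank \<phi> = 0 \<Longrightarrow> defd M X \<phi>"
  by (induction \<phi>) auto

lemma defd_rank_defd_fm: "defd_rank (defd_fm \<phi>) = defd_rank \<phi> - 1"
  by (induction \<phi>) (auto simp: defd_taut_def max_def)

lemma defd_fm_in_lang: "\<phi> \<in> lang_plus A P \<Longrightarrow> defd_fm \<phi> \<in> lang_plus A P"
  by (induction rule: lang_plus.induct) (auto intro: lang_plus.intros)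

lemma facet_if_in_star: "Y \<in> star M a X \<Longrightarrow> Y \<in> facets M"
  by (auto simp: star_def)

lemma colours_if_in_star: "Y \<in> star M a X \<Longrightarrow> a \<in> colours M X"
  by (auto simp: star_def colours_def)

lemma facet_in_star: "X \<in> facets M \<Longrightarrow> a \<in> colours M X \<Longrightarrow> X \<in> star M a X"
  by (simp add: star_def)

lemma sat_defd_fm: "X \<in> facets M \<Longrightarrow> sat M X (defd_fm \<phi>) \<longleftrightarrow> defd M X \<phi>"
proof (induction \<phi> arbitrary: X)
  case (Dia a \<phi>)
  have IH: "sat M Y (defd_fm \<phi>) \<longleftrightarrow> defd M Y \<phi>" if "Y \<in> star M a X" for Y
    using Dia.IH facet_if_in_star[OF that] .
  show ?case
  proof (cases "defd_rank \<phi> = 0")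
    case True
    then have "defd M Y \<phi>" for Y by (rule defd_rank_0)
    \<comment> \<open>With \<open>\<phi>\<close> defined everywhere, the diamond only needs a
      nonempty star; if \<open>a\<close> is alive in \<open>X\<close>, then \<open>X\<close> lies in
      its own star.\<close>
    then have "defd M X (Dia a \<phi>) \<longleftrightarrow> a \<in> colours M X"
      using facet_in_star[OF Dia.prems, of a] colours_if_in_star[of _ M a X] by auto
    with True show ?thesis by simp
  qed (use IH in simp)
qed simp_all

section \<open>Colours and atoms within a single model\<close>

context simplicial_model
begin

lemma facet_subset_verts: "X \<in> facets M \<Longrightarrow> X \<subseteq> verts M"
  using simplex by (auto simp: facets_def)

lemma colours_subset: "X \<in> facets M \<Longrightarrow> colours M X \<subseteq> A"
  using facet_subset_verts colour_agent by (auto simp: colours_def)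

lemma vals_cases:
  assumes "X \<in> facets M" "p \<in> vals M X"
  obtains a where "a \<in> A" "p \<in> P a" "a \<in> colours M X"
proof -
  from assms obtain v where "v \<in> X" "v \<in> verts M" "p \<in> val M v"
    using facet_subset_verts by (auto simp: vals_def)
  then show thesis
    using that[of "colour M v"] colour_agent val_local by (auto simp: colours_def)
qed

text \<open>The clause for \<open>sat\<close> of \<open>Local a p\<close> ignores \<open>a\<close>; disjointness of the sets of local
  atoms ensures that \<open>p\<close> can only be contributed by a vertex of colour \<open>a\<close>.\<close>

lemma sat_imp_defd:
  assumes disj: "disjoint_family_on P A"
  shows "\<phi> \<in> lang_plus A P \<Longrightarrow> X \<in> facets M \<Longrightarrow> sat M X \<phi> \<Longrightarrow> defd M X \<phi>"
proof (induction arbitrary: X rule: lang_plus.induct)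
  case (Local a p)
  then obtain b where "b \<in> A" "p \<in> P b" "b \<in> colours M X"
    using vals_cases[of X p] by auto
  with Local disj have "a = b"
    by (auto simp: disjoint_family_on_def)
  with \<open>b \<in> colours M X\<close> show ?case by simp
next
  case (Dia a \<phi>)
  then show ?case by (auto dest: facet_if_in_star)
qed auto

lemma vals_subset_if_equiv:
  assumes "X \<in> facets M" "equiv_plus A P M X M' X'"
  shows "vals M X \<subseteq> vals M' X'"
proof
  fix p assume p: "p \<in> vals M X"
  \<comment> \<open>An agent owning \<open>p\<close> is needed for \<open>Local a p\<close> to
    belong to the language.\<close>
  with assms obtain a where "a \<in> A" "p \<in> P a" by (auto elim: vals_cases)
  then have "Local a p \<in> lang_plus A P" by (rule lang_plus.Local)
  with assms p show "p \<in> vals M' X'" by (fastforce simp: equiv_plus_def)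
qed

lemma colours_subset_if_equiv:
  assumes "X \<in> facets M" "equiv_plus A P M X M' X'"
  shows "colours M X \<subseteq> colours M' X'"
proof
  fix a assume a: "a \<in> colours M X"
  with assms have "a \<in> A" using colours_subset by blast
  then have "Alive a \<in> lang_plus A P" by (rule lang_plus.Alive)
  with assms a show "a \<in> colours M' X'" by (fastforce simp: equiv_plus_def)
qed

end

section \<open>Equivalence from one-sided preservation of truth\<close>

lemma equiv_plus_sym: "equiv_plus A P M X M' X' \<Longrightarrow> equiv_plus A P M' X' M X"
  by (auto simp: equiv_plus_def)

lemma defd_back_if_sat_mono:
  assumes disj: "disjoint_family_on P A"
    and M': "simplicial_model A P M'"
    and X: "X \<in> facets M" and X': "X' \<in> facets M'"
    and mono: "\<And>\<phi>. \<phi> \<in> lang_plus A P \<Longrightarrow> sat M X \<phi> \<Longrightarrow> sat M' X' \<phi>"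
  shows "\<phi> \<in> lang_plus A P \<Longrightarrow> defd M' X' \<phi> \<Longrightarrow> defd M X \<phi>"
proof (induction "defd_rank \<phi>" arbitrary: \<phi> rule: less_induct)
  case less
  show ?case
  proof (cases "defd_rank \<phi> = 0")
    case True
    then show ?thesis by (rule defd_rank_0)
  next
    case False
    let ?\<delta> = "defd_fm \<phi>"
    have \<delta>: "?\<delta> \<in> lang_plus A P" using less.prems by (simp add: defd_fm_in_lang)
    have sat': "sat M' X' ?\<delta>" using less.prems X' by (simp add: sat_defd_fm)
    then have "defd M' X' ?\<delta>"
      using simplicial_model.sat_imp_defd[OF M' disj \<delta> X'] by blast
    moreover have "defd_rank ?\<delta> < defd_rank \<phi>" using False by (simp add: defd_rank_defd_fm)
    ultimately have "defd M X ?\<delta>" using less.hyps \<delta> by blast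
    \<comment> \<open>If this negation were true at \<open>X\<close>, then \<open>mono\<close> would
      make it true at \<open>X'\<close>, where \<open>?\<delta>\<close> itself is true.\<close>
    moreover have "\<not> sat M X (Neg ?\<delta>)"
      using mono[of "Neg ?\<delta>"] \<delta> sat' by (auto intro: lang_plus.Neg)
    ultimately have "sat M X ?\<delta>" by simp
    then show ?thesis using X by (simp add: sat_defd_fm)
  qed
qed

text \<open>Applying \<open>mono\<close> to \<open>defd_taut \<phi>\<close> carries definedness
  forward; the previous lemma brings it back. Once definedness agrees, \<open>mono\<close> at
  \<open>Neg \<phi>\<close> reflects truth.\<close>

lemma equiv_plus_if_sat_mono:
  assumes disj: "disjoint_family_on P A"
    and M': "simplicial_model A P M'"
    and X: "X \<in> facets M" and X': "X' \<in> facets M'"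
    and mono: "\<And>\<phi>. \<phi> \<in> lang_plus A P \<Longrightarrow> sat M X \<phi> \<Longrightarrow> sat M' X' \<phi>"
  shows "equiv_plus A P M X M' X'"
  unfolding equiv_plus_def
proof
  fix \<phi> assume \<phi>: "\<phi> \<in> lang_plus A P"
  have "defd M X \<phi> \<longleftrightarrow> defd M' X' \<phi>"
    using defd_back_if_sat_mono[OF disj M' X X' mono] mono[of "defd_taut \<phi>"] \<phi> by auto
  moreover have "sat M X \<phi>" if sat': "sat M' X' \<phi>"
  proof -
    have "defd M' X' \<phi>" using simplicial_model.sat_imp_defd[OF M' disj \<phi> X' sat'] .
    moreover have "\<not> sat M X (Neg \<phi>)"
      using mono[of "Neg \<phi>"] \<phi> sat' by (auto intro: lang_plus.Neg)
    ultimately show ?thesis using \<open>defd M X \<phi> \<longleftrightarrow> defd M' X' \<phi>\<close> by simp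
  qed
  ultimately show "(defd M X \<phi> \<longleftrightarrow> defd M' X' \<phi>) \<and> (sat M X \<phi> \<longleftrightarrow> sat M' X' \<phi>) \<and>
      (sat M X (Neg \<phi>) \<longleftrightarrow> sat M' X' (Neg \<phi>))"
    using mono[OF \<phi>] by auto
qed

section \<open>From equivalence to bisimulation\<close>

lemma ex_separating_conj:
  assumes "finite S" "a \<in> A"
    and "\<forall>Z\<in>S. \<exists>\<chi>\<in>lang_plus A P. sat M Y \<chi> \<and> \<not> sat M' Z \<chi>"
  shows "\<exists>\<chi>\<in>lang_plus A P. sat M Y \<chi> \<and> (\<forall>Z\<in>S. \<not> sat M' Z \<chi>)"
  using assms(1,3)
proof (induction S)
  case empty
  \<comment> \<open>The empty conjunction must be true in every facet; it is built from
    \<open>Alive a\<close>, which is always defined.\<close>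
  have "defd_taut (Alive a) \<in> lang_plus A P" using assms(2) by (blast intro: lang_plus.Alive)
  moreover have "sat M Y (defd_taut (Alive a))" by simp
  ultimately show ?case by blast
next
  case (insert Z S)
  then obtain \<chi> \<psi> where "\<chi> \<in> lang_plus A P" "\<psi> \<in> lang_plus A P" "sat M Y \<chi>" "sat M Y \<psi>"
    "\<forall>Z\<in>S. \<not> sat M' Z \<chi>" "\<not> sat M' Z \<psi>" by auto
  then have "Conj \<chi> \<psi> \<in> lang_plus A P" "sat M Y (Conj \<chi> \<psi>)"
    "\<forall>Z\<in>insert Z S. \<not> sat M' Z (Conj \<chi> \<psi>)" by (auto intro: lang_plus.Conj)
  then show ?case by blast
qed

text \<open>If no facet of the star of \<open>X'\<close> matched \<open>Y\<close>, each would fail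
  some formula true at \<open>Y\<close>; the conjunction of these finitely many formulas, placed
  under \<open>Dia a\<close>, would hold at \<open>X\<close> but not at \<open>X'\<close>.\<close>

lemma equiv_plus_forth:
  assumes disj: "disjoint_family_on P A"
    and M': "simplicial_model A P M'" and fin: "star_finite A M'" and X': "X' \<in> facets M'"
    and equiv: "equiv_plus A P M X M' X'"
    and a: "a \<in> A" and Y: "Y \<in> star M a X"
  shows "\<exists>Y'\<in>star M' a X'. equiv_plus A P M Y M' Y'"
proof (rule ccontr)
  assume neg: "\<not> ?thesis"
  have "\<forall>Y'\<in>star M' a X'. \<exists>\<chi>\<in>lang_plus A P. sat M Y \<chi> \<and> \<not> sat M' Y' \<chi>"
  proof (intro ballI, rule ccontr)
    fix Y' assume Y': "Y' \<in> star M' a X'"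
      and "\<not> (\<exists>\<chi>\<in>lang_plus A P. sat M Y \<chi> \<and> \<not> sat M' Y' \<chi>)"
    then have "equiv_plus A P M Y M' Y'"
      by (intro equiv_plus_if_sat_mono[OF disj M' facet_if_in_star[OF Y] facet_if_in_star[OF Y']])
        blast
    with neg Y' show False by blast
  qed
  moreover have "finite (star M' a X')" using fin a X' by (simp add: star_finite_def)
  ultimately have "\<exists>\<chi>\<in>lang_plus A P. sat M Y \<chi> \<and> (\<forall>Y'\<in>star M' a X'. \<not> sat M' Y' \<chi>)"
    by (intro ex_separating_conj[OF _ a])
  then obtain \<chi> where \<chi>: "\<chi> \<in> lang_plus A P" "sat M Y \<chi>"
    "\<forall>Y'\<in>star M' a X'. \<not> sat M' Y' \<chi>" by blast
  have "Dia a \<chi> \<in> lang_plus A P" using a \<chi>(1) by (rule lang_plus.Dia)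
  moreover have "sat M X (Dia a \<chi>)" using Y \<chi>(2) by auto
  ultimately have "sat M' X' (Dia a \<chi>)" using equiv unfolding equiv_plus_def by blast
  with \<chi>(3) show False by simp
qed

lemma bisimulation_equiv_plus:
  assumes disj: "disjoint_family_on P A"
    and M: "simplicial_model A P M" "star_finite A M"
    and M': "simplicial_model A P M'" "star_finite A M'"
    and X: "X \<in> facets M" "X' \<in> facets M'" "equiv_plus A P M X M' X'"
  shows "bisimulation A M M'
    {(Y, Y'). Y \<in> facets M \<and> Y' \<in> facets M' \<and> equiv_plus A P M Y M' Y'}"
    (is "bisimulation A M M' ?B")
  unfolding bisimulation_def
proof (intro conjI)
  show "?B \<noteq> {}" "?B \<subseteq> facets M \<times> facets M'" using X by auto
  have "colours M Y = colours M' Y' \<and> vals M Y = vals M' Y' \<and>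
      (\<forall>a\<in>A. \<forall>Z\<in>star M a Y. \<exists>Z'\<in>star M' a Y'. (Z, Z') \<in> ?B) \<and>
      (\<forall>a\<in>A. \<forall>Z'\<in>star M' a Y'. \<exists>Z\<in>star M a Y. (Z, Z') \<in> ?B)"
    if "Y \<in> facets M" "Y' \<in> facets M'" "equiv_plus A P M Y M' Y'" for Y Y'
  proof (intro conjI ballI)
    note sym = equiv_plus_sym[OF that(3)]
    show "colours M Y = colours M' Y'"
      using simplicial_model.colours_subset_if_equiv M(1) M'(1) that sym
      by (metis subset_antisym)
    show "vals M Y = vals M' Y'"
      using simplicial_model.vals_subset_if_equiv M(1) M'(1) that sym
      by (metis subset_antisym)
    show "\<exists>Z'\<in>star M' a Y'. (Z, Z') \<in> ?B" if "a \<in> A" "Z \<in> star M a Y" for a Z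
      using equiv_plus_forth[OF disj M' \<open>Y' \<in> facets M'\<close> \<open>equiv_plus A P M Y M' Y'\<close> that]
        that by (auto dest: facet_if_in_star)
    \<comment> \<open>Back is forth with the two models exchanged, by symmetry of
      equivalence.\<close>
    show "\<exists>Z\<in>star M a Y. (Z, Z') \<in> ?B" if "a \<in> A" "Z' \<in> star M' a Y'" for a Z'
      using equiv_plus_forth[OF disj M \<open>Y \<in> facets M\<close> sym that]
        that by (auto dest: facet_if_in_star equiv_plus_sym)
  qed
  then show "\<forall>(Y, Y')\<in>?B. colours M Y = colours M' Y' \<and> vals M Y = vals M' Y' \<and>
      (\<forall>a\<in>A. \<forall>Z\<in>star M a Y. \<exists>Z'\<in>star M' a Y'. (Z, Z') \<in> ?B) \<and>
      (\<forall>a\<in>A. \<forall>Z'\<in>star M' a Y'. \<exists>Z\<in>star M a Y. (Z, Z') \<in> ?B)"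
    by blast
qed

section \<open>From bisimulation to equivalence\<close>

text \<open>Definedness and truth share one induction, since truth of a negation depends on
  definedness of its argument. Membership in the language confines the diamonds to agents in
  \<open>A\<close>, for which forth and back are available.\<close>

lemma bisimulation_preserves:
  assumes B: "bisimulation A M M' B"
  shows "\<phi> \<in> lang_plus A P \<Longrightarrow> (X, X') \<in> B \<Longrightarrow>
    (defd M X \<phi> \<longleftrightarrow> defd M' X' \<phi>) \<and> (sat M X \<phi> \<longleftrightarrow> sat M' X' \<phi>)"
proof (induction arbitrary: X X' rule: lang_plus.induct)
  case (Dia a \<phi>)
  have forward: "\<exists>Y'\<in>star M' a X'. (Y, Y') \<in> B" if "Y \<in> star M a X" for Y
    using B Dia.prems Dia.hyps(1) that unfolding bisimulation_def by blast
  have backward: "\<exists>Y\<in>star M a X. (Y, Y') \<in> B" if "Y' \<in> star M' a X'" for Y'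
    using B Dia.prems Dia.hyps(1) that unfolding bisimulation_def by blast
  show ?case using forward backward Dia.IH unfolding defd.simps sat.simps by meson
qed (use B in \<open>auto simp: bisimulation_def\<close>)

lemma equiv_plus_if_bisimilar: "bisimilar A M X M' X' \<Longrightarrow> equiv_plus A P M X M' X'"
  unfolding bisimilar_def equiv_plus_def using bisimulation_preserves by fastforce

theorem theorem4p14:
  fixes A :: "'a set" and P :: "'a \<Rightarrow> 'p set"
    and M :: "('v, 'a, 'p) smodel" and X :: "'v set"
    and M' :: "('w, 'a, 'p) smodel" and X' :: "'w set"
  assumes "finite A"
    and "\<forall>a\<in>A. countable (P a)"
    and "disjoint_family_on P A"
    and "simplicial_model A P M" and "star_finite A M" and "X \<in> facets M"
    and "simplicial_model A P M'" and "star_finite A M'" and "X' \<in> facets M'"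
  shows "equiv_plus A P M X M' X' \<longleftrightarrow> bisimilar A M X M' X'"
proof
  assume "equiv_plus A P M X M' X'"
  with assms show "bisimilar A M X M' X'"
    unfolding bisimilar_def using bisimulation_equiv_plus by blast
qed (rule equiv_plus_if_bisimilar)

end
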